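(* Let $a\in(0,1)$, $c\in(0,a)$, and let $P(z) = (z-a)\prod_{j=1}^{n-1}(z-z_j)$ be a polynomial of degree $n$ that contradicts Sendov's conjecture at $a$. Define $\mathcal{N}_0(a) = \frac{32 \log ( 40/a^2 )}{a^2}$, $$\mathcal{N}_1(a) = \max \left \{ 9 \left( \frac{4+2a}{a} \right)^2 , \mathcal{N}_0(a) \right \},\qquad \mathcal{N}_2(a,c) = \max \left \{ 9 \left( \frac{\log ( a/16 )}{\log \left( \frac{c}{1+a} \right) } \right)^2 , \mathcal{N}_0(a) \right \}.$$ If $n \geq \max \{\mathcal{N}_1(a), \mathcal{N}_2(a,c)\}$, then $|P(c)| \leq 1 + a$.
   Context: A polynomial $P(z) = (z-a)\prod_{j=1}^{n-1}(z-z_j)$ with $a\in(0,1)$ and $|z_j|\le 1$ for all $j$ is said to contradict Sendov's conjecture at $a$ if every zero $w$ of $P'$ satisfies $|w-a|>1$. *)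

theory Defs
  imports "HOL-Analysis.Analysis" "HOL-Computational_Algebra.Polynomial"
begin

definition sendov_poly :: "real \<Rightarrow> (nat \<Rightarrow> complex) \<Rightarrow> nat \<Rightarrow> complex poly" where
  "sendov_poly a zs n = [:- complex_of_real a, 1:] * (\<Prod>j=1..n-1. [:- zs j, 1:])"

definition contradicts_sendov :: "real \<Rightarrow> (nat \<Rightarrow> complex) \<Rightarrow> nat \<Rightarrow> bool" where
  "contradicts_sendov a zs n \<longleftrightarrow>
     0 < a \<and> a < 1 \<and> (\<forall>j\<in>{1..n-1}. cmod (zs j) \<le> 1) \<and>
     (\<forall>w. poly (pderiv (sendov_poly a zs n)) w = 0 \<longrightarrow> cmod (w - complex_of_real a) > 1)"

definition N0 :: "real \<Rightarrow> real" where
  "N0 a = 32 * ln (40 / a^2) / a^2"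

definition N1 :: "real \<Rightarrow> real" where
  "N1 a = max (9 * ((4 + 2*a) / a)^2) (N0 a)"

definition N2 :: "real \<Rightarrow> real \<Rightarrow> real" where
  "N2 a c = max (9 * (ln (a/16) / ln (c / (1 + a)))^2) (N0 a)"

end

theory Submission
  imports Defs "HOL-Computational_Algebra.Fundamental_Theorem_Algebra"
begin

text \<open>
  Let \<open>P\<close> have degree \<open>n = N + 1\<close> and let \<open>w\<^sub>j\<close> be its \<open>N\<close> critical points. By Gauss--Lucas and the
  hypothesis they lie in the lune \<open>\<bar>w\<bar> \<le> 1 < \<bar>w - a\<bar>\<close>, so \<open>\<bar>P'\<bar>\<close> is exponentially smaller in the
  middle of \<open>[0, a]\<close> than at \<open>a\<close>, while \<open>\<bar>P'(a)\<bar> \<ge> n\<close>. Integrating \<open>P'\<close> by parts against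
  \<open>R = P''/P'\<close> near \<open>a\<close>, where \<open>Re R \<ge> N a / 4\<close>, gives \<open>P(t) \<approx> P(3a/4) + P'(t)/R(t)\<close>. As
  \<open>P(a) = 0\<close> and \<open>\<bar>R(a)\<bar> \<le> N\<close>, the plateau value \<open>P(3a/4)\<close> has modulus about
  \<open>\<bar>P'(a)/R(a)\<bar> \<ge> 1\<close>.

  Zeros and critical points share their centroid, whose real part we call \<open>\<mu>\<close>. If \<open>\<mu> \<ge> a/4\<close>, then
  \<open>\<bar>P(\<mu>)\<bar> \<le> exp (- n \<mu>\<^sup>2 / 2)\<close>, by \<open>1 + x \<le> e\<^sup>x\<close> for each factor, contradicting the plateau. If
  \<open>\<mu> < a/4\<close>, then \<open>P'\<close> is negligible on all of \<open>[0, 3a/4]\<close>, so the plateau value is about \<open>P(0)\<close>, of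
  modulus at most \<open>a\<close>. This forces \<open>a \<ge> 17/20\<close>, and the approximation of \<open>P\<close> on \<open>[3a/4, a]\<close> then
  gives the bound.
\<close>

section \<open>Products of linear factors\<close>

lemma monic_prod_linear:
  fixes r :: "'i \<Rightarrow> 'a::idom"
  shows "lead_coeff (\<Prod>j\<in>A. [:- r j, 1:]) = 1"
  by (simp add: lead_coeff_prod)

lemma degree_prod_linear:
  fixes r :: "'i \<Rightarrow> 'a::idom"
  shows "degree (\<Prod>j\<in>A. [:- r j, 1:]) = card A"
  by (subst degree_prod_sum_eq) auto

lemma coeff_prod_linear_subleading:
  fixes r :: "'i \<Rightarrow> 'a::idom"
  assumes "finite A" "A \<noteq> {}"
  shows "coeff (\<Prod>j\<in>A. [:- r j, 1:]) (card A - 1) = - (\<Sum>j\<in>A. r j)"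
  using assms
proof (induction rule: finite_ne_induct)
  case (insert x A)
  let ?p = "\<Prod>j\<in>A. [:- r j, 1:]"
  obtain m where m: "card A = Suc m"
    using insert.hyps by (metis card_gt_0_iff gr0_implies_Suc)
  have "coeff ?p (Suc m) = 1"
    using monic_prod_linear[of r A] by (simp add: degree_prod_linear m)
  moreover have "(\<Prod>j\<in>insert x A. [:- r j, 1:]) = smult (- r x) ?p + pCons 0 ?p"
    using insert.hyps by simp
  ultimately show ?case
    using insert by (simp add: m)
qed simp

lemma centroid_critical_points:
  fixes r s :: "nat \<Rightarrow> 'a::idom"
  assumes "pderiv (\<Prod>j<Suc N. [:- r j, 1:]) = smult (of_nat (Suc N)) (\<Prod>j<N. [:- s j, 1:])"
  shows "of_nat N * (\<Sum>j<Suc N. r j) = of_nat (Suc N) * (\<Sum>j<N. s j)"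
proof (cases N)
  case (Suc m)
  have "of_nat (Suc m) * coeff (\<Prod>j<Suc N. [:- r j, 1:]) N
      = of_nat (Suc N) * coeff (\<Prod>j<N. [:- s j, 1:]) m"
    using arg_cong[OF assms, of "\<lambda>p. coeff p m"] by (simp only: coeff_pderiv coeff_smult Suc)
  hence "of_nat N * - (\<Sum>j<Suc N. r j) = of_nat (Suc N) * - (\<Sum>j<N. s j)"
    using coeff_prod_linear_subleading[of "{..<Suc N}" r] coeff_prod_linear_subleading[of "{..<N}" s]
    by (simp add: Suc lessThan_empty_iff del: prod.lessThan_Suc sum.lessThan_Suc of_nat_Suc)
  thus ?thesis
    by (simp only: mult_minus_right neg_equal_iff_equal)
qed simp

lemma poly_pderiv_prod_linear:
  fixes r :: "'i \<Rightarrow> 'a::field"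
  assumes "\<And>j. j \<in> A \<Longrightarrow> z \<noteq> r j"
  shows "poly (pderiv (\<Prod>j\<in>A. [:- r j, 1:])) z
    = poly (\<Prod>j\<in>A. [:- r j, 1:]) z * (\<Sum>j\<in>A. 1 / (z - r j))"
proof (cases "finite A")
  case True
  have "poly (pderiv (\<Prod>j\<in>A. [:- r j, 1:])) z = (\<Sum>j\<in>A. \<Prod>i\<in>A - {j}. (z - r i))"
    by (simp add: pderiv_prod poly_sum poly_prod pderiv_pCons)
  also have "\<dots> = (\<Sum>j\<in>A. (\<Prod>i\<in>A. (z - r i)) * (1 / (z - r j)))"
    using True assms by (intro sum.cong) (auto simp: prod_diff1)
  finally show ?thesis
    by (simp add: poly_prod sum_distrib_left)
qed simp

lemma in_convex_hull_of_sum_inverse_diff_eq_0: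
  fixes r :: "'i \<Rightarrow> complex"
  assumes "finite I" "I \<noteq> {}" and ne: "\<And>j. j \<in> I \<Longrightarrow> z \<noteq> r j"
    and sum_0: "(\<Sum>j\<in>I. 1 / (z - r j)) = 0"
  shows "z \<in> convex hull (r ` I)"
proof -
  define u where "u j = 1 / (cmod (z - r j))\<^sup>2" for j
  have u_pos: "0 < u j" if "j \<in> I" for j
    using ne[OF that] by (simp add: u_def)
  have sum_pos: "0 < sum u I"
    using assms(1,2) u_pos by (intro sum_pos)
  have "cnj (1 / (z - r j)) = u j *\<^sub>R (z - r j)" for j
    unfolding complex_div_cnj[of 1 "z - r j"] by (simp add: u_def scaleR_conv_of_real)
  hence "(\<Sum>j\<in>I. u j *\<^sub>R (z - r j)) = cnj (\<Sum>j\<in>I. 1 / (z - r j))"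
    by (simp only: cnj_sum)
  hence weighted: "sum u I *\<^sub>R z = (\<Sum>j\<in>I. u j *\<^sub>R r j)"
    by (simp add: sum_0 scaleR_diff_right sum_subtractf scaleR_left.sum)
  have "z = inverse (sum u I) *\<^sub>R (sum u I *\<^sub>R z)"
    using sum_pos by simp
  also have "\<dots> = (\<Sum>j\<in>I. (u j / sum u I) *\<^sub>R r j)"
    unfolding weighted scaleR_right.sum by (simp add: divide_inverse mult.commute)
  also have "\<dots> \<in> convex hull (r ` I)"
    using assms(1) sum_pos u_pos
    by (intro convex_sum convex_convex_hull)
      (auto simp: less_imp_le hull_inc simp flip: sum_divide_distrib)
  finally show ?thesis .
qed

theorem Gauss_Lucas:
  fixes p :: "complex poly"
  assumes "0 < degree p" "poly (pderiv p) z = 0"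
  shows "z \<in> convex hull {x. poly p x = 0}"
proof (cases "poly p z = 0")
  case True
  thus ?thesis
    by (simp add: hull_inc)
next
  case False
  obtain r where p: "smult (lead_coeff p) (\<Prod>j<degree p. [:- r j, 1:]) = p"
    by (rule complex_poly_decompose')
  have root: "poly p (r j) = 0" if "j < degree p" for j
    using that by (subst p[symmetric]) (auto simp: poly_prod)
  hence ne: "z \<noteq> r j" if "j < degree p" for j
    using that False by auto
  have "poly (pderiv p) z = poly p z * (\<Sum>j<degree p. 1 / (z - r j))"
    using poly_pderiv_prod_linear[of "{..<degree p}" z r] ne
    by (subst (1 2) p[symmetric]) (simp add: pderiv_smult)
  hence "z \<in> convex hull (r ` {..<degree p})"
    using assms False ne
    by (intro in_convex_hull_of_sum_inverse_diff_eq_0) (auto simp: lessThan_empty_iff)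
  also have "\<dots> \<subseteq> convex hull {x. poly p x = 0}"
    using root by (intro hull_mono) auto
  finally show ?thesis .
qed

lemma monic_complex_pderiv_decompose:
  fixes p :: "complex poly"
  assumes "lead_coeff p = 1" "degree p = Suc N"
  obtains w where "pderiv p = smult (of_nat (Suc N)) (\<Prod>j<N. [:- w j, 1:])"
proof -
  have deg: "degree (pderiv p) = N"
    using assms(2) by (simp add: degree_pderiv)
  moreover have "lead_coeff (pderiv p) = of_nat (Suc N)"
    using assms unfolding deg coeff_pderiv by simp
  moreover obtain w where
    "smult (lead_coeff (pderiv p)) (\<Prod>j<degree (pderiv p). [:- w j, 1:]) = pderiv p"
    by (rule complex_poly_decompose')
  ultimately have "smult (of_nat (Suc N)) (\<Prod>j<N. [:- w j, 1:]) = pderiv p"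
    by (simp only:)
  thus ?thesis
    by (rule that[OF sym])
qed

section \<open>Comparison with exponentials\<close>

lemma le_mult_exp_of_power2_le:
  fixes x y u :: real
  assumes "x\<^sup>2 \<le> y\<^sup>2 * (1 + 2 * u)" "0 \<le> y"
  shows "x \<le> y * exp u"
proof (rule power2_le_imp_le)
  have "y\<^sup>2 * (1 + 2 * u) \<le> y\<^sup>2 * exp (2 * u)"
    by (intro mult_left_mono exp_ge_add_one_self) auto
  with assms(1) show "x\<^sup>2 \<le> (y * exp u)\<^sup>2"
    by (simp add: power_mult_distrib exp_double)
qed (use assms in simp)

lemma norm_prod_le_exp_sum:
  fixes f g :: "'i \<Rightarrow> 'a::real_normed_field"
  assumes "\<And>j. j \<in> A \<Longrightarrow> norm (f j) \<le> norm (g j) * exp (u j)"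
  shows "norm (\<Prod>j\<in>A. f j) \<le> norm (\<Prod>j\<in>A. g j) * exp (\<Sum>j\<in>A. u j)"
proof (cases "finite A")
  case True
  have "(\<Prod>j\<in>A. norm (f j)) \<le> (\<Prod>j\<in>A. norm (g j) * exp (u j))"
    using assms by (intro prod_mono) auto
  thus ?thesis
    using True by (simp add: prod_norm prod.distrib exp_sum)
qed simp

lemma exp_ge_16_mult:
  fixes y :: real
  assumes "9 / 2 \<le> y"
  shows "16 * y \<le> exp y"
proof -
  have "(13 / 8 :: real) \<le> exp (1 / 2)"
    using exp_lower_Taylor_quadratic[of "1 / 2 :: real"] by (simp add: power2_eq_square)
  hence "(13 / 8 :: real) ^ 9 \<le> exp (1 / 2) ^ 9"
    by (intro power_mono) auto
  also have "\<dots> = exp (9 / 2)"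
    by (simp flip: exp_of_nat_mult)
  finally have "72 \<le> exp (9 / 2 :: real)"
    by (simp add: power_divide)
  hence "72 * (1 + (y - 9 / 2)) \<le> exp (9 / 2) * exp (y - 9 / 2)"
    using assms by (intro mult_mono exp_ge_add_one_self) auto
  also have "\<dots> = exp y"
    by (simp flip: exp_add)
  finally show ?thesis
    using assms by (simp add: field_simps)
qed

section \<open>Points of the lune\<close>

lemma cmod_of_real_diff_power2:
  "(cmod (of_real t - w))\<^sup>2 = t\<^sup>2 - 2 * t * Re w + (cmod w)\<^sup>2"
  unfolding cmod_power2 by (simp add: power2_eq_square algebra_simps)

lemma unit_disc_dist_le_exp:
  assumes "cmod w \<le> 1"
  shows "cmod (of_real x - w) \<le> exp (x\<^sup>2 / 2 - x * Re w)"
proof -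
  have "(cmod w)\<^sup>2 \<le> 1"
    using assms by (simp add: power_le_one)
  hence "(cmod (of_real x - w))\<^sup>2 \<le> 1\<^sup>2 * (1 + 2 * (x\<^sup>2 / 2 - x * Re w))"
    by (simp add: cmod_of_real_diff_power2)
  from le_mult_exp_of_power2_le[OF this] show ?thesis
    by simp
qed

lemma dist_le_dist_mult_exp:
  fixes a t \<kappa> :: real
  assumes "t \<le> a" "\<kappa> * (cmod (of_real a - w))\<^sup>2 \<le> a + t - 2 * Re w"
  shows "cmod (of_real t - w) \<le> cmod (of_real a - w) * exp (- (\<kappa> * (a - t) / 2))"
proof (rule le_mult_exp_of_power2_le)
  have "(cmod (of_real t - w))\<^sup>2 = (cmod (of_real a - w))\<^sup>2 - (a - t) * (a + t - 2 * Re w)"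
    unfolding cmod_of_real_diff_power2 by (simp add: power2_eq_square algebra_simps)
  also have "\<dots> \<le> (cmod (of_real a - w))\<^sup>2 - (a - t) * (\<kappa> * (cmod (of_real a - w))\<^sup>2)"
    using assms by (intro diff_left_mono mult_left_mono) auto
  also have "\<dots> = (cmod (of_real a - w))\<^sup>2 * (1 + 2 * - (\<kappa> * (a - t) / 2))"
    by (simp add: field_simps)
  finally show "(cmod (of_real t - w))\<^sup>2
    \<le> (cmod (of_real a - w))\<^sup>2 * (1 + 2 * - (\<kappa> * (a - t) / 2))" .
qed simp

definition lune :: "real \<Rightarrow> complex set" where
  "lune a = cball 0 1 - cball (of_real a) 1"

lemma lune_iff: "w \<in> lune a \<longleftrightarrow> cmod w \<le> 1 \<and> 1 < cmod (of_real a - w)"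
  by (auto simp: lune_def dist_norm)

lemma lune_norm_power2_le: "w \<in> lune a \<Longrightarrow> (cmod w)\<^sup>2 \<le> 1"
  by (simp add: lune_iff power_le_one)

lemma lune_Re_less:
  assumes "0 < a" "w \<in> lune a"
  shows "Re w < a / 2"
proof -
  have "(cmod w)\<^sup>2 < (cmod (of_real a - w))\<^sup>2"
    using assms by (intro power_strict_mono) (auto simp: lune_iff)
  hence "a * (2 * Re w) < a * a"
    unfolding cmod_of_real_diff_power2 by (simp add: power2_eq_square algebra_simps)
  thus ?thesis
    using assms(1) by simp
qed

lemma lune_dist_le_exp:
  assumes "0 < a" "a \<le> 1" "w \<in> lune a" "0 \<le> t" "t \<le> a"
  shows "cmod (of_real t - w) \<le> cmod (of_real a - w) * exp (- (t * (a - t) / 2))"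
proof (rule dist_le_dist_mult_exp)
  have "t * (cmod (of_real a - w))\<^sup>2 \<le> t * (1 + a * (a - 2 * Re w))"
    unfolding cmod_of_real_diff_power2 using assms lune_norm_power2_le[of w a]
    by (intro mult_left_mono) (auto simp: power2_eq_square algebra_simps)
  also have "\<dots> = t + (t * a) * (a - 2 * Re w)"
    by (simp add: algebra_simps)
  also have "\<dots> \<le> t + 1 * (a - 2 * Re w)"
    using assms lune_Re_less[of a w] by (intro add_left_mono mult_right_mono mult_le_one) auto
  finally show "t * (cmod (of_real a - w))\<^sup>2 \<le> a + t - 2 * Re w"
    by simp
qed (use assms in simp)

lemma lune_dist_le_exp_Re:
  assumes "0 < a" "a \<le> 1" "w \<in> lune a" "0 \<le> t" "t \<le> a"
  shows "cmod (of_real t - w)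
    \<le> cmod (of_real a - w) * exp (- ((a + t - 2 * Re w) / 4 * (a - t) / 2))"
proof (rule dist_le_dist_mult_exp)
  have "cmod (of_real a - w) \<le> cmod (of_real a :: complex) + cmod w"
    by (rule norm_triangle_ineq4)
  also have "\<dots> \<le> 2"
    using assms by (simp add: lune_iff)
  finally have "(cmod (of_real a - w))\<^sup>2 \<le> 2\<^sup>2"
    by (intro power_mono) auto
  hence "(a + t - 2 * Re w) / 4 * (cmod (of_real a - w))\<^sup>2 \<le> (a + t - 2 * Re w) / 4 * 4"
    using assms lune_Re_less[of a w] by (intro mult_left_mono) auto
  thus "(a + t - 2 * Re w) / 4 * (cmod (of_real a - w))\<^sup>2 \<le> a + t - 2 * Re w"
    by simp
qed (use assms in simp)

lemma lune_power2_dist_le: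
  assumes "0 < a" "a \<le> 1" "w \<in> lune a" "a / 2 \<le> t" "t \<le> a"
  shows "(t - a / 2) * (cmod (of_real t - w))\<^sup>2 \<le> t - Re w"
proof -
  define s u where "s = a / 2 - Re w" and "u = t - a / 2"
  have "0 \<le> s" "0 \<le> u" "2 * u * t \<le> 1"
    using assms lune_Re_less[of a w] by (auto simp: s_def u_def intro!: mult_le_one)
  have "(cmod (of_real t - w))\<^sup>2 \<le> 1 + 2 * t * s - t * (a - t)"
    unfolding cmod_of_real_diff_power2 using lune_norm_power2_le[OF assms(3)]
    by (simp add: s_def power2_eq_square algebra_simps)
  also have "\<dots> \<le> 1 + 2 * t * s"
    using assms by simp
  finally have "u * (cmod (of_real t - w))\<^sup>2 \<le> u * (1 + 2 * t * s)"
    using \<open>0 \<le> u\<close> by (rule mult_left_mono)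
  also have "\<dots> = u + (2 * u * t) * s"
    by (simp add: algebra_simps)
  also have "\<dots> \<le> u + 1 * s"
    using \<open>0 \<le> s\<close> \<open>2 * u * t \<le> 1\<close> by (intro add_left_mono mult_right_mono)
  finally show ?thesis
    by (simp add: s_def u_def)
qed

lemma Re_inverse_of_real_diff: "Re (1 / (of_real t - w)) = (t - Re w) / (cmod (of_real t - w))\<^sup>2"
  unfolding cmod_power2 by (simp add: Re_divide)

lemma lune_Re_inverse_ge:
  assumes "0 < a" "a \<le> 1" "w \<in> lune a" "a / 2 \<le> t" "t \<le> a"
  shows "t - a / 2 \<le> Re (1 / (of_real t - w))"
proof -
  have "of_real t \<noteq> w"
    using assms lune_Re_less[of a w] by auto
  thus ?thesis
    unfolding Re_inverse_of_real_diff using lune_power2_dist_le[OF assms] by (simp add: pos_le_divide_eq)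
qed

lemma lune_norm_inverse_power2_le:
  assumes "0 < a" "w \<in> lune a"
  shows "(t - a / 2) * cmod (1 / (of_real t - w)\<^sup>2) \<le> Re (1 / (of_real t - w))"
proof -
  have "(t - a / 2) / (cmod (of_real t - w))\<^sup>2 \<le> (t - Re w) / (cmod (of_real t - w))\<^sup>2"
    using lune_Re_less[OF assms] by (intro divide_right_mono) auto
  thus ?thesis
    by (simp add: Re_inverse_of_real_diff norm_divide norm_power)
qed

section \<open>Integration by parts against a logarithmic derivative\<close>

lemma norm_diff_le_of_norm_derivative_le:
  fixes f f' :: "real \<Rightarrow> 'a::real_normed_vector" and \<phi> \<phi>' :: "real \<Rightarrow> real"
  assumes "s \<le> t"
    and f: "\<And>x. s \<le> x \<Longrightarrow> x \<le> t \<Longrightarrow> (f has_vector_derivative f' x) (at x)"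
    and \<phi>: "\<And>x. s \<le> x \<Longrightarrow> x \<le> t \<Longrightarrow> (\<phi> has_real_derivative \<phi>' x) (at x)"
    and "\<And>x. s \<le> x \<Longrightarrow> x \<le> t \<Longrightarrow> norm (f' x) \<le> \<phi>' x"
  shows "norm (f t - f s) \<le> \<phi> t - \<phi> s"
proof (cases "s = t")
  case False
  show ?thesis
  proof (rule differentiable_bound_general[where f' = f' and \<phi>' = \<phi>'])
    show "continuous_on {s..t} f"
      by (auto intro!: continuous_at_imp_continuous_on has_vector_derivative_continuous f)
    show "continuous_on {s..t} \<phi>"
      by (auto intro!: continuous_at_imp_continuous_on DERIV_isCont \<phi>)
  qed (use False assms in \<open>auto simp: has_real_derivative_iff_has_vector_derivative\<close>)
qed simp

lemma has_real_derivative_cmod: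
  fixes f :: "real \<Rightarrow> complex"
  assumes "(f has_vector_derivative f x * q) (at x)" "f x \<noteq> 0"
  shows "((\<lambda>t. cmod (f t)) has_real_derivative cmod (f x) * Re q) (at x)"
proof -
  have "((\<lambda>t. cmod (f t)) has_derivative (\<lambda>h. inner (h *\<^sub>R (f x * q)) (sgn (f x)))) (at x)"
    using has_derivative_compose[OF assms(1)[unfolded has_vector_derivative_def]
        has_derivative_norm[OF assms(2)]] .
  moreover have "inner (h *\<^sub>R (f x * q)) (sgn (f x)) = cmod (f x) * Re q * h" for h
  proof -
    have "inner (f x * q) (f x) = (cmod (f x))\<^sup>2 * Re q"
      unfolding cmod_power2 inner_complex_def by (simp add: power2_eq_square algebra_simps)
    hence "inner (f x * q) (sgn (f x)) = cmod (f x) * Re q"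
      using assms(2) by (simp add: sgn_div_norm power2_eq_square field_simps)
    thus ?thesis
      by (simp only: inner_scaleR_left mult.commute)
  qed
  ultimately show ?thesis
    unfolding has_field_derivative_def by (simp only:)
qed

text \<open>
  As \<open>(D/R)' = D - (D/R) (R'/R)\<close> and \<open>\<bar>D/R\<bar>\<close> has logarithmic derivative at least \<open>\<rho>\<close>, the boundary term
  \<open>D/R\<close> is a primitive of \<open>D\<close> up to \<open>\<delta>/\<rho>\<close> times its own growth.
\<close>

locale dominated_logderiv =
  fixes b a :: real and D R R' :: "real \<Rightarrow> complex" and \<delta> \<rho> :: real
  assumes D_deriv: "\<lbrakk>b \<le> x; x \<le> a\<rbrakk> \<Longrightarrow> (D has_vector_derivative D x * R x) (at x)"
    and R_deriv: "\<lbrakk>b \<le> x; x \<le> a\<rbrakk> \<Longrightarrow> (R has_vector_derivative R' x) (at x)"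
    and D_nonzero: "\<lbrakk>b \<le> x; x \<le> a\<rbrakk> \<Longrightarrow> D x \<noteq> 0"
    and norm_R'_le: "\<lbrakk>b \<le> x; x \<le> a\<rbrakk> \<Longrightarrow> cmod (R' x) \<le> \<delta> * cmod (R x)"
    and Re_R_ge: "\<lbrakk>b \<le> x; x \<le> a\<rbrakk> \<Longrightarrow> \<rho> + \<delta> \<le> Re (R x)"
    and \<delta>_nonneg: "0 \<le> \<delta>" and \<rho>_pos: "0 < \<rho>"
begin

definition boundary_term :: "real \<Rightarrow> complex" where
  "boundary_term x = D x / R x"

definition boundary_logderiv :: "real \<Rightarrow> complex" where
  "boundary_logderiv x = R x - R' x / R x"

lemma R_nonzero: "\<lbrakk>b \<le> x; x \<le> a\<rbrakk> \<Longrightarrow> R x \<noteq> 0"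
  using Re_R_ge[of x] \<delta>_nonneg \<rho>_pos by auto

lemma norm_R'_div_R_le: "\<lbrakk>b \<le> x; x \<le> a\<rbrakk> \<Longrightarrow> cmod (R' x / R x) \<le> \<delta>"
  using norm_R'_le[of x] R_nonzero[of x] by (simp add: norm_divide divide_le_eq)

lemma Re_boundary_logderiv_ge:
  assumes "b \<le> x" "x \<le> a"
  shows "\<rho> \<le> Re (boundary_logderiv x)"
proof -
  have "Re (R' x / R x) \<le> \<delta>"
    using complex_Re_le_cmod norm_R'_div_R_le[OF assms] by (rule order_trans)
  thus ?thesis
    using Re_R_ge[OF assms] by (simp add: boundary_logderiv_def)
qed

lemma boundary_term_has_vector_derivative:
  assumes "b \<le> x" "x \<le> a"
  shows "(boundary_term has_vector_derivative boundary_term x * boundary_logderiv x) (at x)"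
proof -
  have "((\<lambda>x. D x / R x) has_vector_derivative boundary_term x * boundary_logderiv x) (at x)"
    unfolding has_vector_derivative_def boundary_term_def boundary_logderiv_def
    using assms
    by (auto intro!: derivative_eq_intros
        D_deriv[unfolded has_vector_derivative_def] R_deriv[unfolded has_vector_derivative_def]
        simp: R_nonzero field_simps scaleR_conv_of_real)
  thus ?thesis
    by (simp add: boundary_term_def[abs_def])
qed

lemma norm_boundary_term_has_derivative:
  assumes "b \<le> x" "x \<le> a"
  shows "((\<lambda>x. cmod (boundary_term x)) has_real_derivative
    cmod (boundary_term x) * Re (boundary_logderiv x)) (at x)"
  using boundary_term_has_vector_derivative[OF assms]
  by (rule has_real_derivative_cmod) (simp add: boundary_term_def D_nonzero R_nonzero assms)

lemma norm_boundary_term_growth: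
  assumes "b \<le> s" "s \<le> t" "t \<le> a"
  shows "cmod (boundary_term s) * exp (\<rho> * (t - s)) \<le> cmod (boundary_term t)"
proof -
  let ?g = "\<lambda>x. cmod (boundary_term x) * exp (- (\<rho> * x))"
  have "?g s \<le> ?g t"
  proof (rule DERIV_nonneg_imp_nondecreasing[OF \<open>s \<le> t\<close>])
    fix x assume "s \<le> x" "x \<le> t"
    hence x: "b \<le> x" "x \<le> a"
      using assms by auto
    have "(?g has_real_derivative ?g x * (Re (boundary_logderiv x) - \<rho>)) (at x)"
      by (auto intro!: derivative_eq_intros norm_boundary_term_has_derivative x simp: algebra_simps)
    moreover have "0 \<le> ?g x * (Re (boundary_logderiv x) - \<rho>)"
      using Re_boundary_logderiv_ge[OF x] by simp
    ultimately show "\<exists>y. (?g has_real_derivative y) (at x) \<and> 0 \<le> y"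
      by blast
  qed
  hence "?g s * exp (\<rho> * t) \<le> ?g t * exp (\<rho> * t)"
    by (rule mult_right_mono) simp
  thus ?thesis
    by (simp add: mult.assoc right_diff_distrib flip: exp_add)
qed

context
  fixes Q :: "real \<Rightarrow> complex" and s t :: real
  assumes Q_deriv: "\<And>x. b \<le> x \<Longrightarrow> x \<le> a \<Longrightarrow> (Q has_vector_derivative D x) (at x)"
    and st: "b \<le> s" "s \<le> t" "t \<le> a"
begin

lemma primitive_minus_boundary_term_le:
  "cmod ((Q t - boundary_term t) - (Q s - boundary_term s))
    \<le> \<delta> / \<rho> * (cmod (boundary_term t) - cmod (boundary_term s))"
proof -
  have "cmod ((Q t - boundary_term t) - (Q s - boundary_term s))
      \<le> \<delta> / \<rho> * cmod (boundary_term t) - \<delta> / \<rho> * cmod (boundary_term s)"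
  proof (rule norm_diff_le_of_norm_derivative_le[OF \<open>s \<le> t\<close>])
    fix x assume "s \<le> x" "x \<le> t"
    hence x: "b \<le> x" "x \<le> a"
      using st by auto
    let ?F' = "boundary_term x * boundary_logderiv x"
    show "((\<lambda>x. Q x - boundary_term x) has_vector_derivative D x - ?F') (at x)"
      using x by (intro has_vector_derivative_diff Q_deriv boundary_term_has_vector_derivative)
    show "((\<lambda>x. \<delta> / \<rho> * cmod (boundary_term x)) has_real_derivative
        \<delta> / \<rho> * (cmod (boundary_term x) * Re (boundary_logderiv x))) (at x)"
      using x by (intro DERIV_cmult norm_boundary_term_has_derivative)
    have "D x - ?F' = boundary_term x * (R' x / R x)"
      using R_nonzero[OF x] by (simp add: boundary_term_def boundary_logderiv_def algebra_simps)
    hence "cmod (D x - ?F') = cmod (boundary_term x) * cmod (R' x / R x)"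
      by (simp only: norm_mult)
    also have "\<dots> \<le> cmod (boundary_term x) * \<delta>"
      using norm_R'_div_R_le[OF x] by (rule mult_left_mono) simp
    also have "\<dots> = \<delta> / \<rho> * (cmod (boundary_term x) * \<rho>)"
      using \<rho>_pos by simp
    also have "\<dots> \<le> \<delta> / \<rho> * (cmod (boundary_term x) * Re (boundary_logderiv x))"
      using Re_boundary_logderiv_ge[OF x] \<delta>_nonneg \<rho>_pos by (intro mult_left_mono) auto
    finally show "cmod (D x - ?F')
      \<le> \<delta> / \<rho> * (cmod (boundary_term x) * Re (boundary_logderiv x))" .
  qed
  thus ?thesis
    by (simp only: right_diff_distrib)
qed

lemma norm_primitive_ge_of_vanishing:
  assumes "Q t = 0"
  shows "(1 - \<delta> / \<rho>) * (cmod (boundary_term t) - cmod (boundary_term s)) \<le> cmod (Q s)"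
proof -
  have "boundary_term t
      = boundary_term s - Q s - ((Q t - boundary_term t) - (Q s - boundary_term s))"
    using assms by simp
  also have "cmod \<dots> \<le> (cmod (boundary_term s) + cmod (Q s))
      + cmod ((Q t - boundary_term t) - (Q s - boundary_term s))"
    by (intro norm_triangle_le_diff add_mono order_refl norm_triangle_ineq4)
  finally show ?thesis
    using primitive_minus_boundary_term_le by (simp add: algebra_simps)
qed

lemma norm_primitive_le:
  "cmod (Q t) \<le> cmod (Q s) + (1 + \<delta> / \<rho>) * cmod (boundary_term t) + cmod (boundary_term s)"
proof -
  have "Q t = ((Q t - boundary_term t) - (Q s - boundary_term s))
      + ((Q s - boundary_term s) + boundary_term t)"
    by simp
  also have "cmod \<dots> \<le> cmod ((Q t - boundary_term t) - (Q s - boundary_term s))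
      + ((cmod (Q s) + cmod (boundary_term s)) + cmod (boundary_term t))"
    by (intro norm_triangle_le add_mono order_refl norm_triangle_le_diff)
  also have "\<dots> \<le> \<delta> / \<rho> * (cmod (boundary_term t) - cmod (boundary_term s))
      + ((cmod (Q s) + cmod (boundary_term s)) + cmod (boundary_term t))"
    using primitive_minus_boundary_term_le by simp
  also have "\<dots> \<le> \<delta> / \<rho> * cmod (boundary_term t)
      + ((cmod (Q s) + cmod (boundary_term s)) + cmod (boundary_term t))"
    using \<delta>_nonneg \<rho>_pos by (intro add_right_mono mult_left_mono) auto
  finally show ?thesis
    by (simp add: algebra_simps)
qed

end

end

section \<open>Counterexamples to Sendov's conjecture\<close>

locale sendov_counterexample =
  fixes a :: real and N :: nat and r w :: "nat \<Rightarrow> complex"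
  assumes a_pos: "0 < a" and a_less_1: "a < 1" and N_pos: "0 < N"
    and root_0: "r 0 = of_real a"
    and norm_root_le: "j < Suc N \<Longrightarrow> cmod (r j) \<le> 1"
    and pderiv_roots:
      "pderiv (\<Prod>j<Suc N. [:- r j, 1:]) = smult (of_nat (Suc N)) (\<Prod>j<N. [:- w j, 1:])"
    and dist_critical_point: "j < N \<Longrightarrow> 1 < cmod (w j - of_real a)"
begin

definition P :: "real \<Rightarrow> complex" where
  "P x = poly (\<Prod>j<Suc N. [:- r j, 1:]) (of_real x)"

definition P' :: "real \<Rightarrow> complex" where
  "P' x = poly (pderiv (\<Prod>j<Suc N. [:- r j, 1:])) (of_real x)"

definition logderiv_P' :: "real \<Rightarrow> complex" where
  "logderiv_P' x = (\<Sum>j<N. 1 / (of_real x - w j))"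

definition logderiv_P'_deriv :: "real \<Rightarrow> complex" where
  "logderiv_P'_deriv x = - (\<Sum>j<N. 1 / (of_real x - w j)\<^sup>2)"

definition centroid :: real where
  "centroid = (\<Sum>j<N. Re (w j)) / N"

lemma a_le_1: "a \<le> 1"
  using a_less_1 by simp

lemma P_eq: "P x = (\<Prod>j<Suc N. of_real x - r j)"
  by (simp add: P_def poly_prod del: prod.lessThan_Suc)

lemma P'_eq: "P' x = of_nat (Suc N) * (\<Prod>j<N. of_real x - w j)"
  by (simp add: P'_def pderiv_roots poly_prod del: prod.lessThan_Suc)

lemma P_a: "P a = 0"
  unfolding P_eq by (subst prod.lessThan_Suc_shift) (simp add: root_0)

lemma norm_P_0_le: "cmod (P 0) \<le> a"
proof -
  have "(\<Prod>j<N. cmod (r (Suc j))) \<le> 1"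
    using norm_root_le by (intro prod_le_1) auto
  hence "a * (\<Prod>j<N. cmod (r (Suc j))) \<le> a * 1"
    using a_pos by (intro mult_left_mono) auto
  moreover have "cmod (P 0) = a * (\<Prod>j<N. cmod (r (Suc j)))"
    unfolding P_eq using a_pos
    by (subst prod.lessThan_Suc_shift) (simp add: root_0 norm_mult flip: prod_norm)
  ultimately show ?thesis
    by simp
qed

lemma P_has_vector_derivative: "(P has_vector_derivative P' x) (at x)"
  unfolding P_def[abs_def] P'_def by (intro has_vector_derivative_real_field poly_DERIV)

lemma critical_point_in_lune:
  assumes "j < N"
  shows "w j \<in> lune a"
proof -
  let ?p = "\<Prod>j<Suc N. [:- r j, 1:]"
  have "poly (pderiv ?p) (w j) = 0"
    unfolding pderiv_roots using assms by (auto simp: poly_prod)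
  hence "w j \<in> convex hull {x. poly ?p x = 0}"
    by (intro Gauss_Lucas) (simp_all add: degree_prod_linear del: prod.lessThan_Suc)
  moreover have "{x. poly ?p x = 0} \<subseteq> cball 0 1"
    using norm_root_le by (auto simp: poly_prod simp del: prod.lessThan_Suc)
  hence "convex hull {x. poly ?p x = 0} \<subseteq> cball 0 1"
    by (intro hull_minimal convex_cball)
  ultimately show ?thesis
    using dist_critical_point[OF assms] by (auto simp: lune_iff norm_minus_commute)
qed

lemma sum_Re_critical_points: "(\<Sum>j<N. Re (w j)) = N * centroid"
  using N_pos by (simp add: centroid_def)

lemma sum_Re_roots: "(\<Sum>j<Suc N. Re (r j)) = Suc N * centroid"
proof -
  have "Re (of_nat N * (\<Sum>j<Suc N. r j)) = Re (of_nat (Suc N) * (\<Sum>j<N. w j))"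
    using centroid_critical_points[OF pderiv_roots] by (rule arg_cong)
  hence "N * (\<Sum>j<Suc N. Re (r j)) = N * (Suc N * centroid)"
    by (simp add: sum_Re_critical_points[symmetric] del: sum.lessThan_Suc of_nat_Suc)
  thus ?thesis
    using N_pos by simp
qed

lemma centroid_le: "centroid \<le> a / 2"
proof -
  have "(\<Sum>j<N. Re (w j)) \<le> (\<Sum>j<N. a / 2)"
    using lune_Re_less[OF a_pos critical_point_in_lune] by (intro sum_mono) (auto intro: less_imp_le)
  thus ?thesis
    using N_pos by (simp add: sum_Re_critical_points)
qed

lemma norm_P_centroid_le: "cmod (P centroid) \<le> exp (- (Suc N * centroid\<^sup>2 / 2))"
proof -
  have "cmod (P centroid) \<le> exp (\<Sum>j<Suc N. centroid\<^sup>2 / 2 - centroid * Re (r j))"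
    using norm_prod_le_exp_sum[of "{..<Suc N}" "\<lambda>j. of_real centroid - r j" "\<lambda>_. 1"]
      unit_disc_dist_le_exp norm_root_le
    by (simp add: P_eq del: prod.lessThan_Suc sum.lessThan_Suc)
  also have "(\<Sum>j<Suc N. centroid\<^sup>2 / 2 - centroid * Re (r j)) = - (Suc N * centroid\<^sup>2 / 2)"
    unfolding sum_subtractf sum_distrib_left[symmetric] sum_Re_roots
    by (simp add: power2_eq_square field_simps)
  finally show ?thesis .
qed

lemma norm_P'_a_ge: "Suc N \<le> cmod (P' a)"
proof -
  have "1 \<le> (\<Prod>j<N. cmod (of_real a - w j))"
    using critical_point_in_lune by (intro prod_ge_1) (auto simp: lune_iff less_imp_le)
  hence "real (Suc N) * 1 \<le> real (Suc N) * (\<Prod>j<N. cmod (of_real a - w j))"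
    by (intro mult_left_mono) auto
  thus ?thesis
    unfolding P'_eq norm_mult norm_of_nat prod_norm by simp
qed

lemma norm_P'_le_exp_sum:
  assumes "\<And>j. j < N \<Longrightarrow> cmod (of_real s - w j) \<le> cmod (of_real t - w j) * exp (u j)"
  shows "cmod (P' s) \<le> cmod (P' t) * exp (\<Sum>j<N. u j)"
  unfolding P'_eq norm_mult mult.assoc
  using assms by (intro mult_left_mono norm_prod_le_exp_sum) auto

lemma norm_P'_le_exp:
  assumes "0 \<le> t" "t \<le> a"
  shows "cmod (P' t) \<le> cmod (P' a) * exp (- (N * (t * (a - t)) / 2))"
  using norm_P'_le_exp_sum[of t a "\<lambda>_. - (t * (a - t) / 2)"]
    lune_dist_le_exp[OF a_pos a_le_1 critical_point_in_lune assms] by simp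

lemma norm_P'_le_exp_centroid:
  assumes "0 \<le> t" "t \<le> a"
  shows "cmod (P' t) \<le> cmod (P' a) * exp (- (N * ((a - t) * (a + t - 2 * centroid)) / 8))"
proof -
  have "(\<Sum>j<N. a + t - 2 * Re (w j)) = N * (a + t - 2 * centroid)"
    unfolding sum_subtractf sum_distrib_left[symmetric] sum_Re_critical_points
    by (simp add: algebra_simps)
  hence "(\<Sum>j<N. - ((a + t - 2 * Re (w j)) / 4 * (a - t) / 2))
      = - (N * ((a - t) * (a + t - 2 * centroid)) / 8)"
    unfolding sum_negf sum_divide_distrib[symmetric] sum_distrib_right[symmetric] by simp
  thus ?thesis
    using norm_P'_le_exp_sum[OF lune_dist_le_exp_Re[OF a_pos a_le_1 critical_point_in_lune assms]]
    by simp
qed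

lemma norm_P'_le_norm_P'_a:
  assumes "0 \<le> t" "t \<le> a"
  shows "cmod (P' t) \<le> cmod (P' a)"
proof -
  have "cmod (P' a) * exp (- (N * (t * (a - t)) / 2)) \<le> cmod (P' a) * 1"
    using assms by (intro mult_left_mono) auto
  thus ?thesis
    using norm_P'_le_exp[OF assms] by simp
qed

lemma norm_P_diff_le:
  assumes "s \<le> t" "\<And>x. s \<le> x \<Longrightarrow> x \<le> t \<Longrightarrow> cmod (P' x) \<le> B"
  shows "cmod (P t - P s) \<le> B * (t - s)"
  using norm_diff_le_of_norm_derivative_le[of s t P P' "\<lambda>x. B * x" "\<lambda>_. B"]
    assms P_has_vector_derivative
  by (auto intro!: derivative_eq_intros simp: right_diff_distrib)

lemma critical_point_ne:
  assumes "a / 2 \<le> x" "j < N"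
  shows "of_real x \<noteq> w j"
  using lune_Re_less[OF a_pos critical_point_in_lune] assms by (force simp: complex_eq_iff)

lemma P'_nonzero: "a / 2 \<le> x \<Longrightarrow> P' x \<noteq> 0"
  unfolding P'_eq using critical_point_ne[of x] by (simp del: of_nat_Suc)

lemma P'_has_vector_derivative:
  assumes "a / 2 \<le> x"
  shows "(P' has_vector_derivative P' x * logderiv_P' x) (at x)"
proof -
  have "P' x * logderiv_P' x = poly (pderiv (pderiv (\<Prod>j<Suc N. [:- r j, 1:]))) (of_real x)"
    unfolding P'_def logderiv_P'_def pderiv_roots pderiv_smult poly_smult
    by (subst poly_pderiv_prod_linear) (simp_all add: critical_point_ne[OF assms])
  thus ?thesis
    unfolding P'_def[abs_def] by (auto intro: has_vector_derivative_real_field poly_DERIV)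
qed

lemma logderiv_P'_has_vector_derivative:
  assumes "a / 2 \<le> x"
  shows "(logderiv_P' has_vector_derivative logderiv_P'_deriv x) (at x)"
proof -
  have "((\<lambda>z. \<Sum>j<N. 1 / (z - w j)) has_field_derivative (\<Sum>j<N. - (1 / (of_real x - w j)\<^sup>2)))
      (at (of_real x))"
    by (rule DERIV_sum)
      (use critical_point_ne[OF assms] in
        \<open>auto intro!: derivative_eq_intros simp: power2_eq_square\<close>)
  from has_vector_derivative_real_field[OF this] show ?thesis
    by (simp add: logderiv_P'_def[abs_def] logderiv_P'_deriv_def sum_negf)
qed

lemma Re_logderiv_P'_ge:
  assumes "a / 2 \<le> x" "x \<le> a"
  shows "N * (x - a / 2) \<le> Re (logderiv_P' x)"
proof -
  have "(\<Sum>j<N. x - a / 2) \<le> (\<Sum>j<N. Re (1 / (of_real x - w j)))"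
    using lune_Re_inverse_ge[OF a_pos a_le_1 critical_point_in_lune assms]
    by (intro sum_mono) auto
  thus ?thesis
    by (simp add: logderiv_P'_def)
qed

lemma norm_logderiv_P'_deriv_le:
  assumes "a / 2 \<le> x"
  shows "(x - a / 2) * cmod (logderiv_P'_deriv x) \<le> cmod (logderiv_P' x)"
proof -
  have "(x - a / 2) * cmod (logderiv_P'_deriv x)
      \<le> (x - a / 2) * (\<Sum>j<N. cmod (1 / (of_real x - w j)\<^sup>2))"
    unfolding logderiv_P'_deriv_def norm_minus_cancel
    using assms by (intro mult_left_mono norm_sum) auto
  also have "\<dots> \<le> (\<Sum>j<N. Re (1 / (of_real x - w j)))"
    unfolding sum_distrib_left
    using lune_norm_inverse_power2_le[OF a_pos critical_point_in_lune] by (intro sum_mono) auto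
  also have "\<dots> = Re (logderiv_P' x)"
    by (simp add: logderiv_P'_def)
  also have "\<dots> \<le> cmod (logderiv_P' x)"
    by (rule complex_Re_le_cmod)
  finally show ?thesis .
qed

lemma norm_logderiv_P'_a_le: "cmod (logderiv_P' a) \<le> N"
proof -
  have "cmod (logderiv_P' a) \<le> (\<Sum>j<N. cmod (1 / (of_real a - w j)))"
    unfolding logderiv_P'_def by (rule norm_sum)
  also have "\<dots> \<le> (\<Sum>j<N. 1)"
    using critical_point_in_lune
    by (intro sum_mono) (auto simp: lune_iff norm_divide divide_le_eq_1 less_imp_le)
  finally show ?thesis
    by simp
qed

definition rate :: real where
  "rate = N * a / 4 - 4 / a"

lemma dominated_logderiv_P':
  assumes "0 < rate"
  shows "dominated_logderiv (3 * a / 4) a P' logderiv_P' logderiv_P'_deriv (4 / a) rate"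
proof
  fix x assume x: "3 * a / 4 \<le> x" "x \<le> a"
  hence half: "a / 2 \<le> x" and quarter: "a / 4 \<le> x - a / 2"
    using a_pos by auto
  show "(P' has_vector_derivative P' x * logderiv_P' x) (at x)"
    using half by (rule P'_has_vector_derivative)
  show "(logderiv_P' has_vector_derivative logderiv_P'_deriv x) (at x)"
    using half by (rule logderiv_P'_has_vector_derivative)
  show "P' x \<noteq> 0"
    using half by (rule P'_nonzero)
  have "a / 4 * cmod (logderiv_P'_deriv x) \<le> (x - a / 2) * cmod (logderiv_P'_deriv x)"
    using quarter by (intro mult_right_mono) auto
  hence "a / 4 * cmod (logderiv_P'_deriv x) \<le> cmod (logderiv_P' x)"
    using norm_logderiv_P'_deriv_le[OF half] by linarith
  thus "cmod (logderiv_P'_deriv x) \<le> 4 / a * cmod (logderiv_P' x)"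
    using a_pos by (simp add: field_simps)
  have "N * (a / 4) \<le> N * (x - a / 2)"
    using quarter by (intro mult_left_mono) auto
  thus "rate + 4 / a \<le> Re (logderiv_P' x)"
    using Re_logderiv_P'_ge[OF half x(2)] by (simp add: rate_def)
qed (use a_pos assms in auto)

end

section \<open>Counterexamples of large degree\<close>

locale large_sendov_counterexample = sendov_counterexample +
  assumes large: "N1 a \<le> Suc N"
begin

definition scale :: real where "scale = N * a\<^sup>2"

definition decay :: real where "decay = exp (- (scale / 32))"

lemma a_power2: "0 < a\<^sup>2" "a\<^sup>2 < 1"
  using a_pos a_less_1 by (auto simp: power_less_one_iff)

lemma scale_ge: "144 + 144 * a \<le> scale"
proof -
  have "144 + 144 * a + 36 * a\<^sup>2 = 9 * ((4 + 2 * a) / a)\<^sup>2 * a\<^sup>2"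
    using a_pos by (simp add: field_simps power2_eq_square)
  also have "\<dots> \<le> Suc N * a\<^sup>2"
    using large by (intro mult_right_mono) (auto simp: N1_def)
  also have "\<dots> = scale + a\<^sup>2"
    by (simp add: scale_def algebra_simps)
  finally show ?thesis
    using a_power2 by linarith
qed

lemma scale_le_N: "scale \<le> N"
  unfolding scale_def using a_power2 by (intro mult_left_le) auto

lemma decay_pos: "0 < decay"
  by (simp add: decay_def)

lemma decay_le: "decay \<le> a\<^sup>2 / 38"
proof -
  have "32 * ln (40 / a\<^sup>2) / a\<^sup>2 \<le> Suc N"
    using large by (simp add: N1_def N0_def)
  hence "32 * ln (40 / a\<^sup>2) \<le> Suc N * a\<^sup>2"
    using a_power2(1) by (simp only: pos_divide_le_eq)
  also have "\<dots> \<le> scale + 1"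
    using a_power2(2) by (simp add: scale_def algebra_simps)
  finally have ln_le: "ln (40 / a\<^sup>2) + - (1 / 32) \<le> scale / 32"
    by simp
  have "38 / a\<^sup>2 \<le> 40 / a\<^sup>2 * (1 + - (1 / 32))"
    using a_power2(1) by (simp add: pos_divide_le_eq)
  also have "\<dots> \<le> 40 / a\<^sup>2 * exp (- (1 / 32))"
    by (intro mult_left_mono exp_ge_add_one_self) auto
  also have "\<dots> = exp (ln (40 / a\<^sup>2) + - (1 / 32))"
    unfolding exp_add using a_power2(1) by simp
  also have "\<dots> \<le> exp (scale / 32)"
    using ln_le by simp
  finally have "inverse (exp (scale / 32)) \<le> inverse (38 / a\<^sup>2)"
    using a_power2(1) by (intro le_imp_inverse_le) auto
  thus ?thesis
    by (simp add: decay_def exp_minus)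
qed

lemma decay_le_const: "decay \<le> 1 / 38"
  using decay_le a_power2 by simp

lemma scale_mult_decay_le: "scale * decay \<le> 2"
proof -
  have "scale \<le> 2 * exp (scale / 32)"
    using exp_ge_16_mult[of "scale / 32"] scale_ge a_pos by simp
  thus ?thesis
    by (simp add: decay_def exp_minus field_simps)
qed

lemma N_mult_decay_power2_le: "N * decay\<^sup>2 \<le> 1 / 19"
proof -
  have "N * decay\<^sup>2 * a\<^sup>2 = scale * decay * decay"
    by (simp add: scale_def power2_eq_square)
  also have "\<dots> \<le> 2 * decay"
    using scale_mult_decay_le decay_pos by (intro mult_right_mono) auto
  also have "\<dots> \<le> 1 / 19 * a\<^sup>2"
    using decay_le by simp
  finally show ?thesis
    using a_power2 by (simp only: mult_le_cancel_right_pos)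
qed

lemma N_mult_decay_power3_le: "N * decay ^ 3 \<le> 1 / 722"
proof -
  have "N * decay ^ 3 = N * decay\<^sup>2 * decay"
    by (simp add: power2_eq_square power3_eq_cube)
  also have "\<dots> \<le> 1 / 19 * (1 / 38)"
    using N_mult_decay_power2_le decay_le_const decay_pos by (intro mult_mono) auto
  finally show ?thesis
    by simp
qed

lemma rate_eq: "rate = (scale - 16) / (4 * a)"
  using a_pos by (simp add: rate_def scale_def field_simps power2_eq_square)

lemma rate_pos: "0 < rate"
  unfolding rate_eq using scale_ge a_pos by simp

sublocale dominated_logderiv "3 * a / 4" a P' logderiv_P' logderiv_P'_deriv "4 / a" rate
  using rate_pos by (rule dominated_logderiv_P')

definition error :: real where "error = 4 / a / rate"

lemma error_eq: "error = 16 / (scale - 16)"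
  using a_pos by (simp add: error_def rate_eq)

lemma error_nonneg: "0 \<le> error"
  unfolding error_eq using scale_ge a_pos by simp

lemma error_le_weak: "error \<le> 1 / 8"
  unfolding error_eq using scale_ge a_pos by (simp add: field_simps)

definition peak :: real where "peak = cmod (boundary_term a)"

lemma norm_P'_a_le: "cmod (P' a) \<le> N * peak"
proof -
  have "cmod (P' a) = cmod (logderiv_P' a) * peak"
    using R_nonzero[of a] a_pos by (simp add: peak_def boundary_term_def norm_divide)
  also have "\<dots> \<le> N * peak"
    using norm_logderiv_P'_a_le by (rule mult_right_mono) (simp add: peak_def)
  finally show ?thesis .
qed

lemma peak_ge_1: "1 \<le> peak"
proof -
  have "N * 1 \<le> N * peak"
    using norm_P'_a_ge norm_P'_a_le by simp
  thus ?thesis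
    using N_pos by simp
qed

lemma norm_P'_le_decay_power:
  assumes "cmod (P' t) \<le> cmod (P' a) * exp (- u)" "m * scale / 32 \<le> u"
  shows "cmod (P' t) \<le> N * peak * decay ^ m"
proof -
  have "exp (- u) \<le> decay ^ m"
    using assms(2) by (simp add: decay_def flip: exp_of_nat_mult)
  hence "cmod (P' a) * exp (- u) \<le> N * peak * decay ^ m"
    using norm_P'_a_le peak_ge_1 by (intro mult_mono) auto
  with assms(1) show ?thesis
    by (rule order_trans)
qed

lemma norm_P'_middle_le:
  assumes "a / 4 \<le> t" "t \<le> 3 * a / 4"
  shows "cmod (P' t) \<le> N * peak * decay ^ 3"
proof (rule norm_P'_le_decay_power)
  show "cmod (P' t) \<le> cmod (P' a) * exp (- (N * (t * (a - t)) / 2))"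
    using assms a_pos by (intro norm_P'_le_exp) auto
  have "0 \<le> (t - a / 4) * (3 * a / 4 - t)"
    using assms by (intro mult_nonneg_nonneg) auto
  hence "3 * a\<^sup>2 / 16 \<le> t * (a - t)"
    by (simp add: power2_eq_square field_simps)
  hence "N * (3 * a\<^sup>2 / 16) \<le> N * (t * (a - t))"
    by (intro mult_left_mono) auto
  thus "real 3 * scale / 32 \<le> N * (t * (a - t)) / 2"
    by (simp add: scale_def)
qed

lemma norm_P'_left_le:
  assumes "centroid \<le> a / 4" "0 \<le> t" "t \<le> a / 4"
  shows "cmod (P' t) \<le> N * peak * decay\<^sup>2"
proof (rule norm_P'_le_decay_power)
  show "cmod (P' t) \<le> cmod (P' a) * exp (- (N * ((a - t) * (a + t - 2 * centroid)) / 8))"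
    using assms a_pos by (intro norm_P'_le_exp_centroid) auto
  have "0 \<le> t * (a - 2 * t)"
    using assms by (intro mult_nonneg_nonneg) auto
  hence "a\<^sup>2 / 2 \<le> (a - t) * (a / 2 + t)"
    by (simp add: power2_eq_square field_simps)
  also have "\<dots> \<le> (a - t) * (a + t - 2 * centroid)"
    using assms by (intro mult_left_mono) auto
  finally have "N * (a\<^sup>2 / 2) \<le> N * ((a - t) * (a + t - 2 * centroid))"
    by (intro mult_left_mono) auto
  thus "real 2 * scale / 32 \<le> N * ((a - t) * (a + t - 2 * centroid)) / 8"
    by (simp add: scale_def)
qed

lemma norm_P_diff_le_decay_power:
  assumes "s \<le> t" "\<And>x. s \<le> x \<Longrightarrow> x \<le> t \<Longrightarrow> cmod (P' x) \<le> N * peak * decay ^ m"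
  shows "cmod (P t - P s) \<le> N * decay ^ m * (t - s) * peak"
  using norm_P_diff_le[OF assms] by (simp only: mult_ac)

lemma norm_P_diff_middle_le:
  assumes "a / 4 \<le> s" "s \<le> t" "t \<le> 3 * a / 4"
  shows "cmod (P t - P s) \<le> peak / 722"
proof -
  have "cmod (P t - P s) \<le> N * decay ^ 3 * (t - s) * peak"
    using assms by (intro norm_P_diff_le_decay_power norm_P'_middle_le) auto
  also have "\<dots> \<le> 1 / 722 * 1 * peak"
    using N_mult_decay_power3_le assms a_pos a_less_1 peak_ge_1
    by (intro mult_right_mono mult_mono) auto
  finally show ?thesis
    by simp
qed

lemma norm_P_diff_left_le:
  assumes "centroid \<le> a / 4" "0 \<le> t" "t \<le> a / 4"
  shows "cmod (P t - P 0) \<le> peak / 76"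
proof -
  have "cmod (P t - P 0) \<le> N * decay\<^sup>2 * (t - 0) * peak"
    using assms by (intro norm_P_diff_le_decay_power norm_P'_left_le) auto
  also have "\<dots> \<le> 1 / 19 * (1 / 4) * peak"
    using N_mult_decay_power2_le assms a_less_1 peak_ge_1
    by (intro mult_right_mono mult_mono) auto
  finally show ?thesis
    by simp
qed

lemma norm_boundary_term_left_le: "cmod (boundary_term (3 * a / 4)) \<le> peak / 361"
proof -
  let ?b = "3 * a / 4"
  have "N * a / 4 \<le> Re (logderiv_P' ?b)"
    using Re_logderiv_P'_ge[of ?b] a_pos by simp
  hence "N * a / 4 \<le> cmod (logderiv_P' ?b)"
    using complex_Re_le_cmod order_trans by blast
  hence "cmod (boundary_term ?b) \<le> N * peak * decay ^ 3 / (N * a / 4)"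
    unfolding boundary_term_def norm_divide
    using norm_P'_middle_le[of ?b] N_pos a_pos peak_ge_1 decay_pos by (intro frac_le) auto
  also have "\<dots> = 4 * peak * (decay * decay * (decay / a))"
    using N_pos by (simp add: power3_eq_cube)
  also have "\<dots> \<le> 4 * peak * (1 / 38 * (1 / 38) * 1)"
  proof (intro mult_left_mono mult_mono)
    have "a\<^sup>2 / 38 \<le> a"
      using a_pos a_less_1 by (simp add: power2_eq_square)
    thus "decay / a \<le> 1"
      using decay_le a_pos by simp
  qed (use decay_le_const decay_pos peak_ge_1 a_pos in auto)
  finally show ?thesis
    by simp
qed

lemma norm_P_plateau_ge:
  assumes "error \<le> \<epsilon>" "\<epsilon> \<le> 1"
  shows "(1 - \<epsilon>) * (360 / 361 * peak) \<le> cmod (P (3 * a / 4))"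
proof -
  let ?b = "3 * a / 4"
  have "(1 - \<epsilon>) * (360 / 361 * peak) \<le> (1 - error) * (peak - cmod (boundary_term ?b))"
    using assms norm_boundary_term_left_le peak_ge_1 by (intro mult_mono) auto
  also have "\<dots> \<le> cmod (P ?b)"
    unfolding error_def peak_def
    using P_has_vector_derivative P_a a_pos by (intro norm_primitive_ge_of_vanishing) auto
  finally show ?thesis .
qed

lemma centroid_less: "centroid < a / 4"
proof (rule ccontr)
  assume "\<not> centroid < a / 4"
  hence ge: "a / 4 \<le> centroid"
    by simp
  hence "(a / 4)\<^sup>2 \<le> centroid\<^sup>2"
    using a_pos by (intro power_mono) auto
  hence "N * (a / 4)\<^sup>2 \<le> Suc N * centroid\<^sup>2"
    by (intro mult_mono) auto
  hence "exp (- (Suc N * centroid\<^sup>2 / 2)) \<le> decay"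
    by (simp add: decay_def scale_def power_divide)
  hence "cmod (P centroid) \<le> 1 / 38"
    using norm_P_centroid_le decay_le_const by linarith
  moreover have "cmod (P (3 * a / 4) - P centroid) \<le> peak / 722"
    using ge centroid_le a_pos by (intro norm_P_diff_middle_le) auto
  ultimately have "cmod (P (3 * a / 4)) \<le> 1 / 38 + peak / 722"
    using norm_triangle_sub[of "P (3 * a / 4)" "P centroid"] by linarith
  thus False
    using norm_P_plateau_ge[OF error_le_weak] peak_ge_1 by simp
qed

lemma norm_P_left_le:
  assumes "0 \<le> t" "t \<le> 3 * a / 4"
  shows "cmod (P t) \<le> a + peak / 60"
proof -
  define s where "s = min t (a / 4)"
  have "cmod (P s - P 0) \<le> peak / 76"
    using centroid_less assms a_pos by (intro norm_P_diff_left_le) (auto simp: s_def)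
  moreover have "cmod (P t - P s) \<le> peak / 722"
  proof (cases "t \<le> a / 4")
    case True
    thus ?thesis
      using peak_ge_1 by (simp add: s_def)
  next
    case False
    thus ?thesis
      using assms by (intro norm_P_diff_middle_le) (auto simp: s_def)
  qed
  moreover have "cmod (P t) \<le> cmod (P 0) + cmod (P s - P 0) + cmod (P t - P s)"
    using norm_triangle_sub[of "P t" "P s"] norm_triangle_sub[of "P s" "P 0"] by linarith
  ultimately show ?thesis
    using norm_P_0_le peak_ge_1 by linarith
qed

lemma norm_P_plateau_le: "cmod (P (3 * a / 4)) \<le> a + peak / 60"
  using a_pos by (intro norm_P_left_le) auto

lemma a_ge: "17 / 20 \<le> a"
  using norm_P_plateau_ge[OF error_le_weak] norm_P_plateau_le peak_ge_1 by simp

lemma scale_ge_266: "266 \<le> scale"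
  using scale_ge a_ge by simp

lemma error_le: "error \<le> 8 / 125"
  unfolding error_eq using scale_ge_266 by (simp add: field_simps)

lemma peak_le: "peak \<le> 11 / 10"
  using norm_P_plateau_ge[OF error_le] norm_P_plateau_le a_less_1 by simp

lemma rate_ge: "N / 6 \<le> rate"
proof -
  have "N * (17 / 20) / 4 - 5 \<le> rate"
    unfolding rate_def using a_ge
    by (intro diff_mono divide_right_mono mult_left_mono) (auto simp: field_simps)
  thus ?thesis
    using scale_ge_266 scale_le_N by linarith
qed

lemma norm_P_near_le:
  assumes "0 \<le> c" "c \<le> a" "N * (a - c) \<le> 3 / 2"
  shows "cmod (P c) \<le> 1 + a"
proof -
  have "cmod (P a - P c) \<le> N * peak * (a - c)"
    using assms norm_P'_le_norm_P'_a norm_P'_a_le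
    by (intro norm_P_diff_le) (auto intro: order_trans)
  also have "\<dots> = peak * (N * (a - c))"
    by simp
  also have "\<dots> \<le> 11 / 10 * (3 / 2)"
    using assms peak_le by (intro mult_mono) auto
  also have "\<dots> \<le> 1 + a"
    using a_ge by simp
  finally show ?thesis
    by (simp add: P_a)
qed

lemma norm_P_far_le:
  assumes "3 * a / 4 \<le> c" "c \<le> a" "3 / 2 \<le> N * (a - c)"
  shows "cmod (P c) \<le> 1 + a"
proof -
  have "1 + 1 / 4 \<le> 1 + rate * (a - c)"
    using assms mult_right_mono[OF rate_ge, of "a - c"] by simp
  also have "\<dots> \<le> exp (rate * (a - c))"
    by (rule exp_ge_add_one_self)
  finally have "cmod (boundary_term c) * (1 + 1 / 4) \<le> cmod (boundary_term c) * exp (rate * (a - c))"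
    by (intro mult_left_mono) auto
  also have "\<dots> \<le> peak"
    unfolding peak_def using assms by (intro norm_boundary_term_growth) auto
  finally have "cmod (boundary_term c) \<le> 22 / 25"
    using peak_le by simp
  hence "(1 + error) * cmod (boundary_term c) \<le> (1 + 8 / 125) * (22 / 25)"
    using error_nonneg error_le by (intro mult_mono) auto
  moreover have "cmod (P c) \<le> cmod (P (3 * a / 4)) + (1 + error) * cmod (boundary_term c)
      + cmod (boundary_term (3 * a / 4))"
    unfolding error_def using P_has_vector_derivative assms by (intro norm_primitive_le) auto
  ultimately show ?thesis
    using norm_P_plateau_le norm_boundary_term_left_le peak_le by simp
qed

theorem norm_P_le:
  assumes "0 \<le> c" "c \<le> a"
  shows "cmod (P c) \<le> 1 + a"
proof -
  consider (left) "c \<le> 3 * a / 4" | (near) "N * (a - c) \<le> 3 / 2"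
    | (far) "3 * a / 4 \<le> c" "3 / 2 \<le> N * (a - c)"
    by linarith
  thus ?thesis
  proof cases
    case left
    thus ?thesis
      using norm_P_left_le[of c] assms peak_le by simp
  next
    case near
    thus ?thesis
      using assms by (intro norm_P_near_le)
  next
    case far
    thus ?thesis
      using assms by (intro norm_P_far_le)
  qed
qed

end

definition sendov_root :: "real \<Rightarrow> (nat \<Rightarrow> complex) \<Rightarrow> nat \<Rightarrow> complex" where
  "sendov_root a zs j = (if j = 0 then of_real a else zs j)"

lemma sendov_poly_eq_prod: "sendov_poly a zs (Suc N) = (\<Prod>j<Suc N. [:- sendov_root a zs j, 1:])"
  unfolding sendov_poly_def
  by (subst prod.lessThan_Suc_shift)
    (simp add: sendov_root_def prod.atLeast1_atMost_eq)

lemma contradicts_sendov_imp_counterexample: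
  assumes "contradicts_sendov a zs (Suc N)" "0 < N"
  obtains w where "sendov_counterexample a N (sendov_root a zs) w"
proof -
  let ?p = "\<Prod>j<Suc N. [:- sendov_root a zs j, 1:]"
  have "degree ?p = Suc N"
    by (simp add: degree_prod_linear del: prod.lessThan_Suc)
  then obtain w where w: "pderiv ?p = smult (of_nat (Suc N)) (\<Prod>j<N. [:- w j, 1:])"
    by (rule monic_complex_pderiv_decompose[OF monic_prod_linear])
  have "poly (pderiv ?p) (w j) = 0" if "j < N" for j
    unfolding w using that by (auto simp: poly_prod)
  hence "sendov_counterexample a N (sendov_root a zs) w"
    using assms w
    by unfold_locales (auto simp: contradicts_sendov_def sendov_poly_eq_prod sendov_root_def
        simp del: prod.lessThan_Suc)
  thus ?thesis
    by (rule that)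
qed

lemma N1_gt_1:
  assumes "0 < a" "a < 1"
  shows "1 < N1 a"
proof -
  have "2\<^sup>2 \<le> ((4 + 2 * a) / a)\<^sup>2"
    using assms by (intro power_mono) (auto simp: field_simps)
  thus ?thesis
    by (simp add: N1_def)
qed

theorem mainTheorem5:
  fixes a c :: real and zs :: "nat \<Rightarrow> complex" and n :: nat
  assumes "0 < a" "a < 1" "0 < c" "c < a"
    and "n \<ge> 1"
    and "contradicts_sendov a zs n"
    and "real n \<ge> max (N1 a) (N2 a c)"
  shows "cmod (poly (sendov_poly a zs n) (complex_of_real c)) \<le> 1 + a"
proof -
  obtain N where n: "n = Suc N"
    using assms(5) by (cases n) auto
  have large: "N1 a \<le> Suc N"
    using assms(7) by (simp add: n)
  hence "0 < N"
    using N1_gt_1[OF assms(1,2)] by (cases N) auto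
  then obtain w where "sendov_counterexample a N (sendov_root a zs) w"
    using assms(6) unfolding n by (elim contradicts_sendov_imp_counterexample)
  then interpret sendov_counterexample a N "sendov_root a zs" w .
  interpret large_sendov_counterexample a N "sendov_root a zs" w
    by unfold_locales (rule large)
  have "cmod (P c) \<le> 1 + a"
    using assms(3,4) by (intro norm_P_le) auto
  thus ?thesis
    by (simp add: P_def n sendov_poly_eq_prod del: prod.lessThan_Suc)
qed

end
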